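(* Let $T$ be a tree with at least $3$ vertices and with no vertex of degree $2$. Then $\chi'_{CF}(T)=2$ if and only if $T$ has a maximal matching $M$ such that the subgraph of $T$ induced by $V(M)$ (the set of vertices covered by $M$) has edge set exactly $M$, i.e. $T[V(M)]=M$.
   Context: For a graph $G$ and a vertex $v$, $E_G(v)$ denotes the set of edges incident with $v$; for an edge $uv$, its closed neighbourhood is $E_G(uv)=E_G(u)\cup E_G(v)$. Given an edge-coloring of $G$, a color is a conflict-free color of an edge $e$ if it is assigned to exactly one edge of $E_G(e)$. $G$ is conflict-free $k$-edge-colorable if there is an edge-coloring using $k$ colors in which every edge has a conflict-free color. The conflict-free chromatic index $\chi'_{CF}(G)$ is the least such $k$. *)

theory Defs
  imports "HOL-Library.Disjoint_Sets"
begin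

text \<open>Finite simple graphs: the edges are two-element sets of vertices.\<close>

locale fin_sgraph =
  fixes V :: "'a set" and E :: "'a set set"
  assumes finite_verts: "finite V"
    and edges_wf: "e \<in> E \<Longrightarrow> e \<subseteq> V \<and> card e = 2"

definition walk :: "'a set \<Rightarrow> 'a set set \<Rightarrow> 'a list \<Rightarrow> bool" where
  "walk V E p \<longleftrightarrow> p \<noteq> [] \<and> set p \<subseteq> V \<and> successively (\<lambda>u v. {u, v} \<in> E) p"

definition connected_graph :: "'a set \<Rightarrow> 'a set set \<Rightarrow> bool" where
  "connected_graph V E \<longleftrightarrow>
     V \<noteq> {} \<and> (\<forall>u\<in>V. \<forall>v\<in>V. \<exists>p. walk V E p \<and> hd p = u \<and> last p = v)"

text \<open>A cycle is given by its distinct vertices in cyclic order; the closing edge joins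
  the last vertex to the first.\<close>

definition cycle :: "'a set \<Rightarrow> 'a set set \<Rightarrow> 'a list \<Rightarrow> bool" where
  "cycle V E p \<longleftrightarrow> walk V E p \<and> distinct p \<and> length p \<ge> 3 \<and> {last p, hd p} \<in> E"

locale tree = fin_sgraph +
  assumes connected: "connected_graph V E"
    and acyclic: "\<nexists>p. cycle V E p"

definition incident_edges :: "'a set set \<Rightarrow> 'a \<Rightarrow> 'a set set" where
  "incident_edges E v = {e \<in> E. v \<in> e}"

definition degree :: "'a set set \<Rightarrow> 'a \<Rightarrow> nat" where
  "degree E v = card (incident_edges E v)"

definition closed_nbhd :: "'a set set \<Rightarrow> 'a set \<Rightarrow> 'a set set" where
  "closed_nbhd E e = (\<Union>v\<in>e. incident_edges E v)"

text \<open>Edge colorings are arbitrary, not necessarily proper.\<close>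

definition conflict_free_color :: "'a set set \<Rightarrow> ('a set \<Rightarrow> 'c) \<Rightarrow> 'a set \<Rightarrow> 'c \<Rightarrow> bool" where
  "conflict_free_color E c e a \<longleftrightarrow> (\<exists>!f. f \<in> closed_nbhd E e \<and> c f = a)"

text \<open>The palette has \<open>k\<close> colors; a coloring need not use all of them.\<close>

definition conflict_free_edge_colorable :: "'a set set \<Rightarrow> nat \<Rightarrow> bool" where
  "conflict_free_edge_colorable E k \<longleftrightarrow>
     (\<exists>c :: 'a set \<Rightarrow> nat. c ` E \<subseteq> {..<k} \<and> (\<forall>e\<in>E. \<exists>a. conflict_free_color E c e a))"

definition conflict_free_chromatic_index :: "'a set set \<Rightarrow> nat" where
  "conflict_free_chromatic_index E = (LEAST k. conflict_free_edge_colorable E k)"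

text \<open>In a finite graph the minimum is attained: give all edges different colors.\<close>

lemma (in fin_sgraph) conflict_free_edge_colorable_card:
  "conflict_free_edge_colorable E (card E)"
proof -
  have "E \<subseteq> Pow V" using edges_wf by auto
  then have "finite E" using finite_verts finite_subset by blast
  then obtain c :: "'a set \<Rightarrow> nat" where c: "bij_betw c E {0..<card E}"
    using ex_bij_betw_finite_nat by blast
  have "conflict_free_color E c e (c e)" if e: "e \<in> E" for e
  proof -
    have "e \<noteq> {}" using edges_wf[OF e] by auto
    then have "e \<in> closed_nbhd E e"
      using e by (auto simp: closed_nbhd_def incident_edges_def)
    moreover have "closed_nbhd E e \<subseteq> E"
      by (auto simp: closed_nbhd_def incident_edges_def)
    ultimately show ?thesis
      using bij_betw_imp_inj_on[OF c] e
      unfolding conflict_free_color_def inj_on_def by blast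
  qed
  moreover have "c ` E \<subseteq> {..<card E}"
    using bij_betw_imp_surj_on[OF c] by auto
  ultimately show ?thesis
    unfolding conflict_free_edge_colorable_def by blast
qed

definition matching :: "'a set set \<Rightarrow> 'a set set \<Rightarrow> bool" where
  "matching E M \<longleftrightarrow> M \<subseteq> E \<and> disjoint M"

definition maximal_matching :: "'a set set \<Rightarrow> 'a set set \<Rightarrow> bool" where
  "maximal_matching E M \<longleftrightarrow>
     matching E M \<and> (\<forall>N. matching E N \<and> M \<subseteq> N \<longrightarrow> N = M)"

text \<open>The edge set of the subgraph induced by a vertex set. The vertices covered by a
  matching \<open>M\<close> are \<open>\<Union>M\<close>.\<close>

definition induced_edges :: "'a set set \<Rightarrow> 'a set \<Rightarrow> 'a set set" where
  "induced_edges E S = {e \<in> E. e \<subseteq> S}"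

end

theory Submission
  imports Defs
begin

text \<open>A maximal matching \<open>M\<close> with \<open>T[V(M)] = M\<close> is the same thing as an edge set meeting every
  closed edge neighbourhood exactly once, so coloring \<open>M\<close> against the other edges makes the
  color of \<open>M\<close> conflict-free everywhere. Conversely, fix a conflict-free 2-coloring. Two
  adjacent edges share a vertex of degree at least 3, all of whose edges lie in both closed
  neighbourhoods; if the two edges had different conflict-free colors, each of the two colors
  would occur at most once at that vertex. Hence, by connectivity, a single color is conflict-free
  for all edges, and its color class is \<open>M\<close>.\<close>

section \<open>Closed neighbourhoods and conflict-free colors\<close>

lemma mem_closed_nbhd: "f \<in> closed_nbhd E e \<longleftrightarrow> f \<in> E \<and> e \<inter> f \<noteq> {}"
  by (auto simp: closed_nbhd_def incident_edges_def)

text \<open>The witness is recorded as an edge of \<open>E\<close> so that \<open>a\<close> is known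
  to be a color in use and hence inside any palette bounding \<open>c\<close>.\<close>

lemma conflict_free_colorE:
  assumes "conflict_free_color E c e a"
  obtains g where "g \<in> E" "c g = a" "\<And>h. h \<in> closed_nbhd E e \<Longrightarrow> c h = a \<Longrightarrow> h = g"
proof -
  obtain g where g: "g \<in> closed_nbhd E e" "c g = a"
    and "\<And>h. h \<in> closed_nbhd E e \<and> c h = a \<Longrightarrow> h = g"
    using assms unfolding conflict_free_color_def by (elim ex1E) blast
  moreover have "g \<in> E" using g(1) by (simp add: mem_closed_nbhd)
  ultimately show ?thesis using that by blast
qed

section \<open>Finite graphs and maximal induced matchings\<close>

context fin_sgraph
begin

lemma finite_edges: "finite E"
  by (rule finite_subset[of _ "Pow V"]) (use edges_wf finite_verts in auto)

lemma edge_nonempty: "e \<in> E \<Longrightarrow> e \<noteq> {}"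
  using edges_wf by fastforce

lemma edge_eqI:
  assumes "e \<in> E" "f \<in> E" "e \<subseteq> f"
  shows "e = f"
proof (rule card_subset_eq)
  show "finite f" using edges_wf[OF assms(2)] finite_verts finite_subset by blast
qed (use edges_wf assms in auto)

text \<open>Existence of \<open>f\<close> encodes maximality: an edge missing all of
  \<open>M\<close> could be added to it. Uniqueness encodes both disjointness and inducedness: an
  edge joining two members of \<open>M\<close> would see both of them.\<close>

lemma maximal_induced_matching_iff:
  "maximal_matching E M \<and> induced_edges E (\<Union>M) = M \<longleftrightarrow>
    M \<subseteq> E \<and> (\<forall>e\<in>E. \<exists>!f. f \<in> closed_nbhd E e \<and> f \<in> M)" (is "?L \<longleftrightarrow> ?R")
proof
  assume L: ?L
  then have ME: "M \<subseteq> E" and disj: "disjoint M" and ind: "induced_edges E (\<Union>M) = M"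
    and max: "\<And>N. matching E N \<Longrightarrow> M \<subseteq> N \<Longrightarrow> N = M"
    by (auto simp: maximal_matching_def matching_def)
  have same: "f = g" if "f \<in> M" "g \<in> M" "x \<in> f" "x \<in> g" for f g x
    using disj that by (auto simp: disjoint_def)
  have "\<exists>!f. f \<in> closed_nbhd E e \<and> f \<in> M" if e: "e \<in> E" for e
  proof (rule ex_ex1I)
    show "\<exists>f. f \<in> closed_nbhd E e \<and> f \<in> M"
    proof (rule ccontr)
      assume "\<not> ?thesis"
      then have none: "e \<inter> f = {}" if "f \<in> M" for f
        using that ME by (auto simp: mem_closed_nbhd)
      then have "matching E (insert e M)"
        using disj ME e by (auto simp: matching_def disjoint_def)
      then have "e \<in> M" using max by blast
      then show False using none edge_nonempty[OF e] by blast
    qed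
  next
    fix f g
    assume fg: "f \<in> closed_nbhd E e \<and> f \<in> M" "g \<in> closed_nbhd E e \<and> g \<in> M"
    then obtain x y where x: "x \<in> e" "x \<in> f" and y: "y \<in> e" "y \<in> g"
      by (auto simp: mem_closed_nbhd)
    show "f = g"
    proof (cases "x = y")
      case True
      then show ?thesis using same fg x y by blast
    next
      case False
      \<comment> \<open>Both ends of \<open>e\<close> are covered by \<open>M\<close>, so
        inducedness puts \<open>e\<close> itself into \<open>M\<close>, where it shares a vertex
        with \<open>f\<close> and with \<open>g\<close>.\<close>
      have "e = {x, y}"
        using edges_wf[OF e] x y False by (auto simp: card_2_iff)
      then have "e \<in> induced_edges E (\<Union>M)"
        using e fg x y by (auto simp: induced_edges_def)
      then have "e \<in> M" using ind by simp
      then show ?thesis using same fg x y by blast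
    qed
  qed
  then show ?R using ME by blast
next
  assume ?R
  then have ME: "M \<subseteq> E" and R: "\<And>e. e \<in> E \<Longrightarrow> \<exists>!f. f \<in> closed_nbhd E e \<and> f \<in> M"
    by blast+
  have uniq: "f = g"
    if "e \<in> E" "f \<in> M" "g \<in> M" "e \<inter> f \<noteq> {}" "e \<inter> g \<noteq> {}" for e f g
    using R[OF that(1)] that ME by (auto simp: mem_closed_nbhd)
  \<comment> \<open>Here \<open>f\<close> serves as its own center: it meets itself, being nonempty,
    and would also meet \<open>g\<close>.\<close>
  have disj: "f \<inter> g = {}" if "f \<in> M" "g \<in> M" "f \<noteq> g" for f g
    using uniq[of f f g] that ME edge_nonempty[of f] by auto
  have "N = M" if N: "matching E N" "M \<subseteq> N" for N
  proof -
    have "e \<in> M" if e: "e \<in> N" for e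
    proof -
      have "e \<in> E" using N e by (auto simp: matching_def)
      then obtain f where f: "f \<in> M" "e \<inter> f \<noteq> {}"
        using R unfolding mem_closed_nbhd by blast
      then have "e = f"
        using N e unfolding matching_def disjoint_def by blast
      then show ?thesis using f by simp
    qed
    then show ?thesis using N by blast
  qed
  then have "maximal_matching E M"
    using ME disj by (auto simp: maximal_matching_def matching_def disjoint_def)
  moreover have "e \<in> M" if e: "e \<in> E" "e \<subseteq> \<Union>M" for e
  proof -
    obtain f where f: "f \<in> M" "e \<inter> f \<noteq> {}"
      using R[OF e(1)] unfolding mem_closed_nbhd by blast
    \<comment> \<open>Each vertex of \<open>e\<close> is covered by a member of \<open>M\<close>,
      which meets \<open>e\<close> and must therefore be \<open>f\<close>.\<close>
    have "e \<subseteq> f"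
    proof
      fix x assume "x \<in> e"
      then obtain g where "g \<in> M" "x \<in> g" using e by blast
      then show "x \<in> f" using uniq[OF e(1) f(1), of g] f \<open>x \<in> e\<close> by blast
    qed
    then show ?thesis using edge_eqI[OF e(1)] f ME by blast
  qed
  ultimately show ?L using ME by (auto simp: induced_edges_def)
qed

section \<open>Connectivity seen from the edges\<close>

lemma walk_edges_constant:
  assumes adj: "\<And>e f. e \<in> E \<Longrightarrow> f \<in> E \<Longrightarrow> e \<inter> f \<noteq> {} \<Longrightarrow> P e = P f"
    and "walk V E p" "e \<in> E" "hd p \<in> e" "f \<in> E" "last p \<in> f"
  shows "P e = P f"
  using assms(2-)
proof (induction p arbitrary: e)
  case Nil
  then show ?case by (simp add: walk_def)
next
  case (Cons x p)
  show ?case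
  proof (cases p)
    case Nil
    then have "x \<in> e \<inter> f" using Cons.prems by simp
    then show ?thesis using adj Cons.prems by blast
  next
    case (Cons y q)
    then have xy: "{x, y} \<in> E" "walk V E p"
      using Cons.prems by (auto simp: walk_def)
    \<comment> \<open>The first edge of the walk meets \<open>e\<close> in \<open>x\<close>. It then
      replaces \<open>e\<close> for the remaining walk, which starts at \<open>y\<close>; hence the
      induction keeps \<open>e\<close> arbitrary.\<close>
    have "P e = P {x, y}"
      using adj[of e "{x, y}"] xy Cons.prems by auto
    also have "\<dots> = P f"
      using Cons.IH[of "{x, y}"] xy Cons Cons.prems by auto
    finally show ?thesis .
  qed
qed

lemma connected_edges_constant:
  assumes "connected_graph V E"
    and "\<And>e f. e \<in> E \<Longrightarrow> f \<in> E \<Longrightarrow> e \<inter> f \<noteq> {} \<Longrightarrow> P e = P f"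
    and "e \<in> E" "f \<in> E"
  shows "P e = P f"
proof -
  obtain u v where uv: "u \<in> e" "v \<in> f" using edge_nonempty[OF assms(3)] edge_nonempty[OF assms(4)] by blast
  then have "u \<in> V" "v \<in> V" using assms edges_wf by blast+
  then obtain p where "walk V E p" "hd p = u" "last p = v"
    using assms(1) unfolding connected_graph_def by blast
  then show ?thesis
    using uv assms(3,4) by (intro walk_edges_constant[of P p e f, OF assms(2)]) auto
qed

lemma connected_incident_edge:
  assumes "connected_graph V E" "card V \<ge> 2" "u \<in> V"
  obtains e where "e \<in> E" "u \<in> e"
proof -
  have "V \<noteq> {u}" using assms(2) by auto
  then obtain v where "v \<in> V" "v \<noteq> u" using assms(3) by blast
  then obtain p where p: "walk V E p" "hd p = u" "last p = v"
    using assms unfolding connected_graph_def by blast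
  then obtain x y q where "p = x # y # q"
    \<comment> \<open>The rule \<open>remdups_adj.cases\<close> only supplies the split into lists
      of length 0, 1 and at least 2; the ends differ, so the last case holds.\<close>
    using \<open>v \<noteq> u\<close> by (cases p rule: remdups_adj.cases) (auto simp: walk_def)
  then show ?thesis using p that[of "{x, y}"] by (auto simp: walk_def)
qed

lemma connected_ex_adjacent_edges:
  assumes "connected_graph V E" "card V \<ge> 3"
  obtains e f where "e \<in> E" "f \<in> E" "e \<noteq> f" "e \<inter> f \<noteq> {}"
proof (rule ccontr)
  assume "\<not> thesis"
  then have "e = f" if "e \<in> E" "f \<in> E" "e \<inter> f \<noteq> {}" for e f
    using that \<open>\<And>e f. \<lbrakk>e \<in> E; f \<in> E; e \<noteq> f; e \<inter> f \<noteq> {}\<rbrakk> \<Longrightarrow> thesis\<close> by blast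
  \<comment> \<open>Taking \<open>P\<close> to be the identity, connectivity leaves at most one
    edge. It would have to cover all of \<open>V\<close>, which has too many vertices.\<close>
  then have eq: "e = f" if "e \<in> E" "f \<in> E" for e f
    using connected_edges_constant[OF assms(1), of "\<lambda>e. e"] that by blast
  have inc: "\<exists>e\<in>E. u \<in> e" if "u \<in> V" for u
    using connected_incident_edge[OF assms(1) _ that] assms(2) by (metis Suc_leD numeral_2_eq_2 numeral_3_eq_3)
  obtain u where "u \<in> V" using assms(1) by (auto simp: connected_graph_def)
  then obtain e where e: "e \<in> E" using inc by blast
  then have "V \<subseteq> e" using inc eq by blast
  then have "V = e" using edges_wf[OF e] by blast
  then show False using edges_wf[OF e] assms(2) by simp
qed

section \<open>Colorings with at most two colors\<close>

lemma two_le_colors_of_conflict_free: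
  assumes "connected_graph V E" "card V \<ge> 3" "conflict_free_edge_colorable E k"
  shows "2 \<le> k"
proof -
  obtain e f where ef: "e \<in> E" "f \<in> E" "e \<noteq> f" "e \<inter> f \<noteq> {}"
    using connected_ex_adjacent_edges assms by blast
  obtain c :: "'a set \<Rightarrow> nat" where c: "c ` E \<subseteq> {..<k}"
    and "\<forall>e\<in>E. \<exists>a. conflict_free_color E c e a"
    using assms(3) unfolding conflict_free_edge_colorable_def by blast
  then obtain a where cf: "conflict_free_color E c e a" using ef(1) by blast
  have nb: "e \<in> closed_nbhd E e" "f \<in> closed_nbhd E e"
    using ef edge_nonempty by (auto simp: mem_closed_nbhd)
  obtain g where a: "g \<in> E" "c g = a" "\<And>h. h \<in> closed_nbhd E e \<Longrightarrow> c h = a \<Longrightarrow> h = g"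
    using conflict_free_colorE[OF cf] by blast
  \<comment> \<open>The edges \<open>e\<close> and \<open>f\<close> are distinct, so they cannot
    both be the only edge of color \<open>a\<close> near \<open>e\<close>; one of them has another
    color.\<close>
  then obtain h where "h \<in> E" "c h \<noteq> c g" using nb ef by metis
  moreover have "c h < k" "c g < k" using c a \<open>h \<in> E\<close> by auto
  ultimately show ?thesis by linarith
qed

lemma adjacent_conflict_free_colors_eq:
  assumes deg: "\<forall>v\<in>V. degree E v \<noteq> 2"
    and c: "c ` E \<subseteq> {..<2::nat}"
    and ef: "e \<in> E" "f \<in> E" "e \<noteq> f" "e \<inter> f \<noteq> {}"
    and a: "conflict_free_color E c e a" and b: "conflict_free_color E c f b"
  shows "a = b"
proof (rule ccontr)
  assume "a \<noteq> b"
  obtain v where v: "v \<in> e" "v \<in> f" using ef by blast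
  let ?I = "incident_edges E v"
  have "v \<in> V" using v ef edges_wf by blast
  have fin: "finite ?I" using finite_edges by (simp add: incident_edges_def)
  have "{e, f} \<subseteq> ?I" using v ef by (auto simp: incident_edges_def)
  \<comment> \<open>The degree of \<open>v\<close> is at least 2 and differs from 2.\<close>
  then have "card {e, f} \<le> card ?I" by (rule card_mono[OF fin])
  then have "card ?I \<ge> 3"
    using deg \<open>v \<in> V\<close> ef by (force simp: degree_def)
  obtain g where g: "g \<in> E" "c g = a" "\<And>h. h \<in> closed_nbhd E e \<Longrightarrow> c h = a \<Longrightarrow> h = g"
    using conflict_free_colorE[OF a] by blast
  obtain g' where g': "g' \<in> E" "c g' = b" "\<And>h. h \<in> closed_nbhd E f \<Longrightarrow> c h = b \<Longrightarrow> h = g'"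
    using conflict_free_colorE[OF b] by blast
  have "?I \<subseteq> {g, g'}"
  proof
    fix h assume h: "h \<in> ?I"
    have "h \<in> closed_nbhd E e" "h \<in> closed_nbhd E f" "h \<in> E"
      using h v by (auto simp: mem_closed_nbhd incident_edges_def)
    \<comment> \<open>As distinct colors of edges, \<open>a\<close> and \<open>b\<close> exhaust the
      palette.\<close>
    moreover have "c h < 2" "a < 2" "b < 2" using c g g' \<open>h \<in> E\<close> by auto
    then have "c h = a \<or> c h = b" using \<open>a \<noteq> b\<close> by linarith
    ultimately show "h \<in> {g, g'}" using g g' by blast
  qed
  then have "card ?I \<le> card {g, g'}" by (rule card_mono[rotated]) simp
  also have "\<dots> \<le> 2" by (simp add: card_insert_if)
  finally show False using \<open>card ?I \<ge> 3\<close> by simp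
qed

lemma conflict_free_2_colorable_iff:
  assumes conn: "connected_graph V E"
    and deg: "\<forall>v\<in>V. degree E v \<noteq> 2"
  shows "conflict_free_edge_colorable E 2 \<longleftrightarrow>
    (\<exists>M. maximal_matching E M \<and> induced_edges E (\<Union>M) = M)"
proof
  assume "conflict_free_edge_colorable E 2"
  then obtain c :: "'a set \<Rightarrow> nat" and P where c: "c ` E \<subseteq> {..<2}"
    and P: "\<And>e. e \<in> E \<Longrightarrow> conflict_free_color E c e (P e)"
    unfolding conflict_free_edge_colorable_def by metis
  have adj: "P e = P f" if "e \<in> E" "f \<in> E" "e \<inter> f \<noteq> {}" for e f
    using adjacent_conflict_free_colors_eq[OF deg c that(1,2) _ that(3) P P] that by blast
  obtain a where a: "\<And>e. e \<in> E \<Longrightarrow> P e = a"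
    using connected_edges_constant[of P, OF conn adj] by metis
  have "\<forall>e\<in>E. \<exists>!f. f \<in> closed_nbhd E e \<and> f \<in> {f \<in> E. c f = a}"
  proof
    fix e assume "e \<in> E"
    then have "\<exists>!f. f \<in> closed_nbhd E e \<and> c f = a"
      using P[of e] a by (simp add: conflict_free_color_def)
    then show "\<exists>!f. f \<in> closed_nbhd E e \<and> f \<in> {f \<in> E. c f = a}"
      by (auto simp: mem_closed_nbhd)
  qed
  then show "\<exists>M. maximal_matching E M \<and> induced_edges E (\<Union>M) = M"
    unfolding maximal_induced_matching_iff by (intro exI[of _ "{f \<in> E. c f = a}"]) simp
next
  assume "\<exists>M. maximal_matching E M \<and> induced_edges E (\<Union>M) = M"
  then obtain M where "maximal_matching E M \<and> induced_edges E (\<Union>M) = M" ..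
  then have "\<forall>e\<in>E. \<exists>!f. f \<in> closed_nbhd E e \<and> f \<in> M"
    unfolding maximal_induced_matching_iff by (rule conjunct2)
  \<comment> \<open>The coloring is the indicator of \<open>M\<close>: color 1 occurs once near
    \<open>e\<close> exactly when one member of \<open>M\<close> lies there.\<close>
  then have "\<forall>e\<in>E. conflict_free_color E (\<lambda>f. of_bool (f \<in> M) :: nat) e 1"
    unfolding conflict_free_color_def of_bool_eq_1_iff .
  then show "conflict_free_edge_colorable E 2"
    unfolding conflict_free_edge_colorable_def
    by (intro exI[of _ "\<lambda>f. of_bool (f \<in> M)"]) auto
qed

lemma conflict_free_chromatic_index_eq_2_iff:
  assumes "connected_graph V E" "card V \<ge> 3"
  shows "conflict_free_chromatic_index E = 2 \<longleftrightarrow> conflict_free_edge_colorable E 2"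
proof
  assume "conflict_free_chromatic_index E = 2"
  then show "conflict_free_edge_colorable E 2"
    \<comment> \<open>The least value is attained because \<open>card E\<close> colors
      suffice.\<close>
    unfolding conflict_free_chromatic_index_def
    using LeastI[of "conflict_free_edge_colorable E", OF conflict_free_edge_colorable_card] by simp
next
  assume "conflict_free_edge_colorable E 2"
  then show "conflict_free_chromatic_index E = 2"
    unfolding conflict_free_chromatic_index_def
    by (rule Least_equality) (rule two_le_colors_of_conflict_free[OF assms])
qed

end

theorem theorem2:
  fixes V :: "'a set" and E :: "'a set set"
  assumes "tree V E"
    and "card V \<ge> 3"
    and "\<forall>v\<in>V. degree E v \<noteq> 2"
  shows "conflict_free_chromatic_index E = 2 \<longleftrightarrow>
    (\<exists>M. maximal_matching E M \<and> induced_edges E (\<Union>M) = M)"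
proof -
  interpret tree V E by fact
  show ?thesis
    using conflict_free_chromatic_index_eq_2_iff[OF connected assms(2)]
      conflict_free_2_colorable_iff[OF connected assms(3)] by simp
qed

end
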